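(* For every $i\in\mathbb{Z}_4$, the following relation holds on every nonzero finite-dimensional $\square_q$-module $V$ (i.e. as an equality in $\mathrm{End}(V)$): $$\exp_q(\mathfrak{n}_{i,i+1})^{-1}\,x_{i+2}\,\exp_q(\mathfrak{n}_{i,i+1})=x_{i}-\frac{x_{i+2}}{(q-q^{-1})^2}+\frac{q\,x_{i}x_{i+2}x_{i}^{-1}}{(q-q^{-1})(q^2-q^{-2})}+\frac{q^{-1}x_{i}^{-1}x_{i+2}x_{i}}{(q-q^{-1})(q^2-q^{-2})}.$$
   Context: Let $\mathbb{F}$ be an algebraically closed field and let $0\ne q\in\mathbb{F}$ be not a root of unity. Algebras are associative with $1$. For $n\in\mathbb{Z}$, $[n]_q=(q^n-q^{-n})/(q-q^{-1})$; for $n\in\mathbb{N}=\{0,1,2,\dots\}$, $[n]_q^!=\prod_{k=1}^n[k]_q$ with $[0]_q^!=1$. Let $\mathbb{Z}_4=\mathbb{Z}/4\mathbb{Z}$; indices are taken in $\mathbb{Z}_4$. $\square_q$ is the $\mathbb{F}$-algebra with generators $\{x_i\}_{i\in\mathbb{Z}_4}$ and relations, for $i\in\mathbb{Z}_4$, $$\frac{qx_ix_{i+1}-q^{-1}x_{i+1}x_i}{q-q^{-1}}=1,\qquad x_i^3x_{i+2}-[3]_qx_i^2x_{i+2}x_i+[3]_qx_ix_{i+2}x_i^2-x_{i+2}x_i^3=0.$$ For $i\in\mathbb{Z}_4$ put $\mathfrak{n}_{i,i+1}=\dfrac{q(1-x_ix_{i+1})}{q-q^{-1}}=\dfrac{q^{-1}(1-x_{i+1}x_i)}{q-q^{-1}}\in\square_q$.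 On every nonzero finite-dimensional $\square_q$-module each $x_i$ acts invertibly, and $x_i^{-1}$ denotes the inverse of that action; each $\mathfrak{n}_{i,i+1}$ acts nilpotently. For a nilpotent $\psi\in\mathrm{End}(V)$, $V$ a nonzero finite-dimensional $\mathbb{F}$-vector space, $\exp_q(\psi)=\sum_{n\in\mathbb{N}}\frac{q^{\binom n2}}{[n]_q^!}\psi^n$, which is invertible. *)

theory Defs
  imports
    "HOL-Algebra.QuotRing"
    "HOL-Computational_Algebra.Polynomial"
    "HOL-Library.Numeral_Type"
    "HOL-Library.Poly_Mapping"
begin

section \<open>The free algebra on generators indexed by the integers modulo 4\<close>

text \<open>
  The type \<open>4\<close> of \<open>HOL-Library.Numeral_Type\<close> is the ring of integers modulo 4, so that \<open>i + 1\<close> and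
  \<open>i + 2\<close> wrap around. The free monoid is written additively because the multiplication of
  \<^typ>\<open>'a \<Rightarrow>\<^sub>0 'b\<close> is the convolution product along \<open>+\<close> on \<^typ>\<open>'a\<close>; finitely supported
  functions on the free monoid thus form the free associative unital algebra.
\<close>

datatype 'a free_monoid = Word "'a list"

instantiation free_monoid :: (type) monoid_add
begin

definition zero_free_monoid :: "'a free_monoid" where
  "zero_free_monoid = Word []"

fun plus_free_monoid :: "'a free_monoid \<Rightarrow> 'a free_monoid \<Rightarrow> 'a free_monoid" where
  "plus_free_monoid (Word u) (Word v) = Word (u @ v)"

instance
proof
  fix a b c :: "'a free_monoid"
  show "a + b + c = a + (b + c)"
    by (cases a; cases b; cases c) simp
  show "0 + a = a" "a + 0 = a"
    by (cases a; simp add: zero_free_monoid_def)+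
qed

end

type_synonym 'f free_alg = "4 free_monoid \<Rightarrow>\<^sub>0 'f"

definition free_const :: "'f::field \<Rightarrow> 'f free_alg" where
  "free_const c = Poly_Mapping.single 0 c"

definition free_gen :: "4 \<Rightarrow> 'f::field free_alg" where
  "free_gen i = Poly_Mapping.single (Word [i]) 1"

definition free_ring :: "'f::field free_alg ring" where
  "free_ring = \<lparr>carrier = UNIV, monoid.mult = (*), one = 1, zero = 0, add = (+)\<rparr>"


section \<open>The algebra $\square_q$\<close>

definition q_int :: "'f::field \<Rightarrow> int \<Rightarrow> 'f" where
  "q_int q n = (q powi n - q powi (- n)) / (q - inverse q)"

definition q_fact :: "'f::field \<Rightarrow> nat \<Rightarrow> 'f" where
  "q_fact q n = (\<Prod>k=1..n. q_int q (int k))"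

definition square_rels :: "'f::field \<Rightarrow> 'f free_alg set" where
  "square_rels q =
     (\<Union>i. {free_const (1 / (q - inverse q)) *
             (free_const q * free_gen i * free_gen (i + 1)
                - free_const (inverse q) * free_gen (i + 1) * free_gen i) - 1,
           free_gen i ^ 3 * free_gen (i + 2)
             - free_const (q_int q 3) * free_gen i ^ 2 * free_gen (i + 2) * free_gen i
             + free_const (q_int q 3) * free_gen i * free_gen (i + 2) * free_gen i ^ 2
             - free_gen (i + 2) * free_gen i ^ 3})"

definition square_ideal :: "'f::field \<Rightarrow> 'f free_alg set" where
  "square_ideal q = Idl\<^bsub>free_ring\<^esub> (square_rels q)"

definition square_q :: "'f::field \<Rightarrow> 'f free_alg set ring" where
  "square_q q = free_ring Quot square_ideal q"

definition square_class :: "'f::field \<Rightarrow> 'f free_alg \<Rightarrow> 'f free_alg set" where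
  "square_class q p = square_ideal q +>\<^bsub>free_ring\<^esub> p"

definition square_gen :: "'f::field \<Rightarrow> 4 \<Rightarrow> 'f free_alg set" where
  "square_gen q i = square_class q (free_gen i)"

text \<open>
  The element $\mathfrak{n}_{i,i+1}$, by the first of its two equivalent expressions; the second
  one is proved as \<open>square_nil_alt\<close> below.
\<close>

definition square_nil :: "'f::field \<Rightarrow> 4 \<Rightarrow> 'f free_alg set" where
  "square_nil q i =
     square_class q (free_const (q / (q - inverse q)) * (1 - free_gen i * free_gen (i + 1)))"


section \<open>Modules\<close>

text \<open>
  A unital left $\square_q$-module: \<open>act a\<close> is the action of the element \<open>a\<close> of the quotient
  algebra. The axiom \<open>act_const\<close> says that the vector space structure is the one induced by the
  scalars of $\square_q$.
\<close>

locale square_q_module = vector_space scale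
  for scale :: "'f::field \<Rightarrow> 'v::ab_group_add \<Rightarrow> 'v" +
  fixes q :: 'f
    and act :: "'f free_alg set \<Rightarrow> 'v \<Rightarrow> 'v"
  assumes act_linear: "a \<in> carrier (square_q q) \<Longrightarrow> Vector_Spaces.linear scale scale (act a)"
    and act_add: "a \<in> carrier (square_q q) \<Longrightarrow> b \<in> carrier (square_q q) \<Longrightarrow>
      act (a \<oplus>\<^bsub>square_q q\<^esub> b) v = act a v + act b v"
    and act_mult: "a \<in> carrier (square_q q) \<Longrightarrow> b \<in> carrier (square_q q) \<Longrightarrow>
      act (a \<otimes>\<^bsub>square_q q\<^esub> b) v = act a (act b v)"
    and act_one: "act \<one>\<^bsub>square_q q\<^esub> v = v"
    and act_const: "act (square_class q (free_const c)) v = scale c v"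

text \<open>
  \<^const>\<open>Sum_any\<close> sums over the support of the summand, which is finite for nilpotent \<open>\<psi>\<close>.
\<close>

definition exp_q :: "('f::field \<Rightarrow> 'v::ab_group_add \<Rightarrow> 'v) \<Rightarrow> 'f \<Rightarrow> ('v \<Rightarrow> 'v) \<Rightarrow> 'v \<Rightarrow> 'v" where
  "exp_q scale q \<psi> v = Sum_any (\<lambda>n. scale (q ^ (n choose 2) / q_fact q n) ((\<psi> ^^ n) v))"


section \<open>Basic facts\<close>

lemma ring_free_ring: "ring (free_ring :: 'f::field free_alg ring)"
proof (rule ringI)
  show "abelian_group (free_ring :: 'f free_alg ring)"
  proof (rule abelian_groupI)
    fix x :: "'f free_alg"
    show "\<exists>y\<in>carrier free_ring. y \<oplus>\<^bsub>free_ring\<^esub> x = \<zero>\<^bsub>free_ring\<^esub>"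
      by (rule bexI[of _ "- x"]) (simp_all add: free_ring_def)
  qed (simp_all add: free_ring_def algebra_simps)
  show "monoid (free_ring :: 'f free_alg ring)"
    by (rule monoidI) (simp_all add: free_ring_def algebra_simps)
qed (simp_all add: free_ring_def algebra_simps)

lemma ideal_square_ideal: "ideal (square_ideal q) free_ring"
  unfolding square_ideal_def
  by (rule ring.genideal_ideal[OF ring_free_ring]) (simp add: free_ring_def)

lemma square_rels_subset: "square_rels q \<subseteq> square_ideal q"
  unfolding square_ideal_def
  by (rule ring.genideal_self[OF ring_free_ring]) (simp add: free_ring_def)

lemma square_class_hom: "square_class q \<in> ring_hom free_ring (square_q q)"
  unfolding square_q_def square_class_def by (rule ideal.rcos_ring_hom[OF ideal_square_ideal])

lemma square_class_carrier: "square_class q p \<in> carrier (square_q q)"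
  using ring_hom_closed[OF square_class_hom] by (simp add: free_ring_def)

lemma square_class_eqI:
  assumes "p = r + s" "r \<in> square_ideal q"
  shows "square_class q p = square_class q s"
proof -
  interpret ideal "square_ideal q" free_ring by (rule ideal_square_ideal)
  have "p \<in> square_ideal q +>\<^bsub>free_ring\<^esub> s"
    using assms by (auto simp: a_r_coset_def' free_ring_def)
  then show ?thesis
    unfolding square_class_def by (metis a_repr_independence' UNIV_I free_ring_def partial_object.select_convs(1))
qed

lemma square_class_rel: "r \<in> square_rels q \<Longrightarrow> square_class q r = \<zero>\<^bsub>square_q q\<^esub>"
  using square_rels_subset[of q]
    abelian_subgroup.a_rcos_const[OF abelian_subgroupI3[OF ideal.axioms(1)[OF ideal_square_ideal]
      ring.is_abelian_group[OF ring_free_ring]], of r q]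
  by (auto simp: square_class_def square_q_def FactRing_def)

lemma free_const_mult: "free_const (a * b) = free_const a * free_const b"
  by (simp add: free_const_def mult_single)

lemma free_const_diff: "free_const (a - b) = free_const a - free_const b"
  by (simp add: free_const_def single_diff)

lemma square_nil_alt:
  assumes "q - inverse q \<noteq> 0"
  shows "square_nil q i = square_class q
    (free_const (inverse q / (q - inverse q)) * (1 - free_gen (i + 1) * free_gen i))"
proof -
  let ?c = "free_const :: 'a \<Rightarrow> 'a free_alg" and ?d = "1 / (q - inverse q)"
  let ?x = "free_gen i :: 'a free_alg" and ?y = "free_gen (i + 1) :: 'a free_alg"
  let ?r = "?c ?d * (?c q * ?x * ?y - ?c (inverse q) * ?y * ?x) - 1"
  interpret ideal "square_ideal q" free_ring by (rule ideal_square_ideal)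
  have "?r \<in> square_ideal q"
    using square_rels_subset[of q] by (auto simp: square_rels_def)
  then have r: "?c (- 1) * ?r \<in> square_ideal q"
    using I_l_closed[of ?r "?c (- 1)"] by (simp add: free_ring_def)
  have one: "?c (?d * q) - ?c (?d * inverse q) = 1"
  proof -
    have "?d * q - ?d * inverse q = 1"
      using assms by (simp add: diff_divide_distrib[symmetric])
    then show ?thesis
      by (metis free_const_def free_const_diff single_one)
  qed
  have m1: "?c (- 1) * p = - p" for p
    by (simp add: free_const_def single_uminus)
  have "?c (q / (q - inverse q)) * (1 - ?x * ?y) =
      ?c (- 1) * ?r + ?c (inverse q / (q - inverse q)) * (1 - ?y * ?x)"
  proof -
    have "?c (q / (q - inverse q)) = ?c ?d * ?c q"
      "?c (inverse q / (q - inverse q)) = ?c ?d * ?c (inverse q)"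
      by (simp_all add: free_const_mult[symmetric])
    moreover have "(?c ?d * ?c q) * (?x * ?y) = (1 + ?c ?d * ?c (inverse q)) * (?x * ?y)"
      using one unfolding free_const_mult by (metis add.commute diff_add_cancel)
    ultimately show ?thesis
      using one unfolding m1 free_const_mult by (simp add: algebra_simps)
  qed
  then show ?thesis
    unfolding square_nil_def by (rule square_class_eqI[OF _ r])
qed

end

theory Submission
  imports Defs
begin

text \<open>
  Write $x, y, z$ for the actions of $x_i, x_{i+1}, x_{i+2}$, and let $n$ be the action of
  $\mathfrak{n}_{i,i+1}$ and $E = \exp_q(n) = \sum_k t_k$ with $t_k$ a multiple of $n^k$. The proof
  sorts endomorphisms by their weight, that is, their eigenvalue under conjugation by $x$.

  The relation between $x$ and $y$ alone shows that $x$ is invertible (\<open>inj_x\<close>), that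
  $n x = q^2 x n$, hence that $n$ has weight $q^{-2}$ and is nilpotent (\<open>nil_nilpotent\<close>), and
  that $E^{-1} y E = x^{-1}$ (\<open>y_exp_x\<close>), where the sum over $k$ telescopes.

  Put $w = E^{-1} z E - x$. Conjugating the relation between $y$ and $z$ by $E$ gives the same relation
  between $x^{-1}$ and $x + w$, and this says exactly that $w$ has weight $q^2$ (\<open>x_defect\<close>). On
  the other hand, the cubic relation factors as $(T - q^2)(T - 1)(T - q^{-2})\,z = 0$ for the
  conjugation $T$ by $x$, so $z = z_+ + z_0 + z_-$ with summands of weight $q^2, 1, q^{-2}$
  (\<open>z_decomposition\<close>).

  In $(z_+ + z_0 + z_-)\,E = E\,(x + w)$ the term $t_k$ has weight $q^{-2k}$, so the parts of weight $q^2$ are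
  $z_+$ on the left and $w$ on the right. Different weights are independent
  (\<open>weight_component_eq_zero\<close>), so $w = z_+$ (\<open>defect_eq_z_plus\<close>). Finally $z_+$, written out as the
  projection of $z$, is the right-hand side of the theorem minus $x$.
\<close>

section \<open>Weights and the action of a polynomial\<close>

lemma (in vector_space) linear_funpow:
  assumes "Vector_Spaces.linear scale scale f"
  shows "Vector_Spaces.linear scale scale (f ^^ k)"
proof -
  interpret f: Vector_Spaces.linear scale scale f by (rule assms)
  have "(f ^^ k) (v + w) = (f ^^ k) v + (f ^^ k) w" "(f ^^ k) (scale c v) = scale c ((f ^^ k) v)"
    for v w c
    by (induction k) (simp_all add: f.add f.scale)
  then show ?thesis
    by unfold_locales
qed

text \<open>
  This is $p(f)\,v$, evaluated by the Horner scheme so that \<open>pCons\<close> is the induction step.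
\<close>

definition poly_act ::
    "('a::zero \<Rightarrow> 'b \<Rightarrow> 'b) \<Rightarrow> 'a poly \<Rightarrow> ('b \<Rightarrow> 'b) \<Rightarrow> 'b \<Rightarrow> 'b::ab_group_add" where
  "poly_act scale p f v = fold_coeffs (\<lambda>a w. scale a v + f w) p 0"

context vector_space
begin

text \<open>
  Say that \<open>A\<close> has weight \<open>c\<close> if \<open>f (A v) = c A (R v)\<close>. For \<open>R = f\<close> invertible this says that \<open>A\<close> is
  an eigenvector of conjugation by \<open>f\<close> in the algebra of endomorphisms; for \<open>R = id\<close> and \<open>A\<close> constant
  it speaks of the eigenvectors of \<open>f\<close> itself. The lemma is the independence of different weights,
  in the form needed later: the components \<open>A k\<close> may share weights with one another, only the weight
  of \<open>C\<close> is isolated. As usual, a component \<open>k0\<close> is removed by subtracting its multiple of the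
  relation from the transformed relation; surjectivity of \<open>R\<close> allows one to cancel \<open>R\<close> afterwards.
\<close>

lemma weight_component_eq_zero:
  fixes A :: "'k \<Rightarrow> 'w \<Rightarrow> 'b" and C :: "'w \<Rightarrow> 'b"
  assumes f: "Vector_Spaces.linear scale scale f" and R: "surj R"
    and K: "finite K"
    and A: "\<And>k v. k \<in> K \<Longrightarrow> f (A k v) = scale (wt k) (A k (R v))"
    and C: "\<And>v. f (C v) = scale \<mu> (C (R v))"
    and ne: "\<And>k. k \<in> K \<Longrightarrow> wt k \<noteq> \<mu>"
    and sum: "\<And>v. (\<Sum>k\<in>K. A k v) + C v = 0"
  shows "C v = 0"
proof -
  interpret f: Vector_Spaces.linear scale scale f by (rule f)
  show ?thesis
    using K A C ne sum
  proof (induction K arbitrary: A C v rule: finite_induct)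
    case empty
    then show ?case by simp
  next
    case (insert k0 K)
    define A' where "A' k v = scale (wt k - wt k0) (A k (R v))" for k v
    define C' where "C' v = scale (\<mu> - wt k0) (C (R v))" for v
    have "C' v = 0" for v
    proof (rule insert.IH)
      show "f (A' k v) = scale (wt k) (A' k (R v))" if "k \<in> K" for k v
        using insert.prems(1)[of k] that by (simp add: A'_def f.scale mult.commute)
      show "f (C' v) = scale \<mu> (C' (R v))" for v
        using insert.prems(2) by (simp add: C'_def f.scale mult.commute)
      show "wt k \<noteq> \<mu>" if "k \<in> K" for k
        using insert.prems(3) that by simp
      show "(\<Sum>k\<in>K. A' k v) + C' v = 0" for v
      proof -
        have "f ((\<Sum>k\<in>insert k0 K. A k v) + C v)
            - scale (wt k0) ((\<Sum>k\<in>insert k0 K. A k (R v)) + C (R v)) = 0"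
          using insert.prems(4) by simp
        moreover have "f (\<Sum>k\<in>K. A k v) = (\<Sum>k\<in>K. scale (wt k) (A k (R v)))"
          using insert.prems(1) by (simp add: f.sum)
        ultimately show ?thesis
          using insert.hyps insert.prems(1)[of k0] insert.prems(2)
          by (simp add: A'_def C'_def f.add scale_right_distrib scale_left_diff_distrib
              scale_sum_right sum_subtractf algebra_simps)
      qed
    qed
    then have "C (R v) = 0" for v
      using insert.prems(3)[of k0] by (auto simp: C'_def)
    then show ?case
      using R by (metis surjD)
  qed
qed

context
  fixes f
  assumes lin: "Vector_Spaces.linear scale scale f"
begin

interpretation f: Vector_Spaces.linear scale scale f by (rule lin)

lemma poly_act_0: "poly_act scale 0 f v = 0"
  by (simp add: poly_act_def)

lemma poly_act_pCons: "poly_act scale (pCons a p) f v = scale a v + f (poly_act scale p f v)"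
  by (cases "p = 0"; cases "a = 0") (simp_all add: poly_act_def f.zero)

lemma poly_act_add: "poly_act scale (p + r) f v = poly_act scale p f v + poly_act scale r f v"
  by (induction p r rule: poly_induct2)
     (simp_all add: poly_act_0 poly_act_pCons f.add scale_left_distrib)

lemma poly_act_smult: "poly_act scale (smult c p) f v = scale c (poly_act scale p f v)"
  by (induction p) (simp_all add: poly_act_0 poly_act_pCons f.scale scale_right_distrib)

lemma poly_act_diff: "poly_act scale (p - r) f v = poly_act scale p f v - poly_act scale r f v"
  using poly_act_add[of p "smult (- 1) r" v] by (simp only: poly_act_smult) simp

lemma poly_act_monom: "poly_act scale (monom c k) f v = scale c ((f ^^ k) v)"
  by (induction k) (simp_all add: monom_0 monom_Suc poly_act_0 poly_act_pCons f.zero f.scale)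

lemma poly_act_shift: "poly_act scale p f (f v) = f (poly_act scale p f v)"
  by (induction p) (simp_all add: poly_act_0 poly_act_pCons f.zero f.add f.scale)

lemma poly_act_linear_factor:
  "poly_act scale ([:- c, 1:] * p) f v = f (poly_act scale p f v) - scale c (poly_act scale p f v)"
  by (simp add: poly_act_diff poly_act_smult poly_act_pCons)

lemma subspace_poly_act: "subspace {poly_act scale p f v |p. degree p < Suc k}"
proof (rule subspaceI)
  show "0 \<in> {poly_act scale p f v |p. degree p < Suc k}"
    using poly_act_0 by (auto intro!: exI[of _ 0])
next
  fix u w
  assume "u \<in> {poly_act scale p f v |p. degree p < Suc k}" "w \<in> {poly_act scale p f v |p. degree p < Suc k}"
  then obtain p r where "u = poly_act scale p f v" "w = poly_act scale r f v" "degree p < Suc k" "degree r < Suc k"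
    by auto
  then show "u + w \<in> {poly_act scale p f v |p. degree p < Suc k}"
    by (auto intro!: exI[of _ "p + r"] degree_add_less simp: poly_act_add)
next
  fix c u
  assume "u \<in> {poly_act scale p f v |p. degree p < Suc k}"
  then obtain p where "u = poly_act scale p f v" "degree p < Suc k"
    by auto
  then show "scale c u \<in> {poly_act scale p f v |p. degree p < Suc k}"
    by (auto intro!: exI[of _ "smult c p"] le_less_trans[OF degree_smult_le] simp: poly_act_smult)
qed

end

end


section \<open>Linear maps on a finite-dimensional space\<close>

context finite_dimensional_vector_space
begin

text \<open>
  The eigenvectors would be an infinite independent set, since different eigenvalues are independent.
  This is the common source of contradiction below: because $q$ is not a root of unity, a $q$-commutation
  relation turns one unwanted eigenvector into infinitely many with distinct eigenvalues.
\<close>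

lemma no_infinite_eigenvector_sequence:
  fixes e :: "nat \<Rightarrow> 'b"
  assumes f: "Vector_Spaces.linear scale scale f"
    and e: "\<And>k. f (e k) = scale (\<mu> k) (e k)" and "inj \<mu>" and nz: "\<And>k. e k \<noteq> 0"
  shows False
proof -
  have inj: "inj e"
  proof (rule injI)
    fix i j assume "e i = e j"
    then have "scale (\<mu> i) (e i) = scale (\<mu> j) (e i)"
      by (metis e)
    then show "i = j"
      using \<open>inj \<mu>\<close> nz[of i] by (simp add: inj_eq)
  qed
  have "independent (range e)"
    unfolding independent_explicit_finite_subsets
  proof (intro allI impI ballI)
    fix T u v
    assume T: "T \<subseteq> range e" "finite T" "(\<Sum>v\<in>T. scale (u v) v) = 0" "v \<in> T"
    have ev: "f w = scale (\<mu> (inv_into UNIV e w)) w" if "w \<in> T" for w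
      using that T(1) e inj by auto
    have "scale (u v) v = 0"
    proof (rule weight_component_eq_zero[OF f, where R = id and K = "T - {v}"
          and A = "\<lambda>w _. scale (u w) w" and wt = "\<lambda>w. \<mu> (inv_into UNIV e w)" and \<mu> = "\<mu> (inv_into UNIV e v)"
          and C = "\<lambda>_::unit. scale (u v) v"])
      interpret f: Vector_Spaces.linear scale scale f by (rule f)
      show "f (scale (u w) w) = scale (\<mu> (inv_into UNIV e w)) (scale (u w) w)" if "w \<in> T - {v}" for w
        using ev[of w] that by (simp add: f.scale mult.commute)
      show "f (scale (u v) v) = scale (\<mu> (inv_into UNIV e v)) (scale (u v) v)"
        using ev[of v] T by (simp add: f.scale mult.commute)
      show "\<mu> (inv_into UNIV e w) \<noteq> \<mu> (inv_into UNIV e v)" if "w \<in> T - {v}" for w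
        using that T inv_into_injective[of UNIV e w v] by (auto simp: inj_eq[OF \<open>inj \<mu>\<close>])
      show "(\<Sum>w\<in>T - {v}. scale (u w) w) + scale (u v) v = 0"
        using T by (simp add: sum.remove[of T v] add.commute)
    qed (use T in auto)
    then show "u v = 0"
      using T nz by auto
  qed
  then have "finite (range e)"
    by (rule finiteI_independent)
  then show False
    using inj finite_imageD by blast
qed

text \<open>
  The iterates $v, f v, f^2 v, \dots$ cannot all be independent of their predecessors, and
  the first dependence is a monic polynomial that kills $v$.
\<close>

lemma exists_annihilating_poly:
  assumes f: "Vector_Spaces.linear scale scale f"
  shows "\<exists>p. p \<noteq> 0 \<and> poly_act scale p f v = 0"
proof -
  let ?S = "\<lambda>k. (\<lambda>j. (f ^^ j) v) ` {..<k}"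
  have "\<exists>k. (f ^^ k) v \<in> span (?S k)"
  proof (rule ccontr)
    assume *: "\<nexists>k. (f ^^ k) v \<in> span (?S k)"
    have "independent (?S k) \<and> card (?S k) = k" for k
    proof (induction k)
      case 0
      then show ?case by (simp add: independent_empty)
    next
      case (Suc k)
      have notin: "(f ^^ k) v \<notin> span (?S k)"
        using * by blast
      then have "card (insert ((f ^^ k) v) (?S k)) = Suc k"
        using Suc span_base by (subst card_insert_disjoint) auto
      then show ?case
        unfolding lessThan_Suc image_insert using Suc independent_insertI[OF notin] by blast
    qed
    then have ind: "independent (?S (Suc (dim UNIV)))" "card (?S (Suc (dim UNIV))) = Suc (dim UNIV)"
      by blast+
    have "Suc (dim UNIV) \<le> dim UNIV"
      using independent_card_le_dim[OF subset_UNIV ind(1)] by (simp only: ind(2))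
    then show False by simp
  qed
  then obtain k where k: "(f ^^ k) v \<in> span (?S k)" ..
  show ?thesis
  proof (cases k)
    case 0
    then have "v = 0" using k by simp
    then show ?thesis
      by (intro exI[of _ 1]) (simp add: one_pCons poly_act_pCons[OF f] poly_act_0[OF f] module_hom.zero[OF module_hom_linearI[OF f]])
  next
    case (Suc m)
    have "span (?S k) \<subseteq> {poly_act scale p f v |p. degree p < Suc m}"
    proof (rule span_minimal[OF _ subspace_poly_act[OF f]])
      have "(f ^^ j) v = poly_act scale (monom 1 j) f v \<and> degree (monom (1::'a) j) < Suc m"
        if "j < k" for j
        using that Suc by (simp add: poly_act_monom[OF f] degree_monom_eq)
      then show "?S k \<subseteq> {poly_act scale p f v |p. degree p < Suc m}"
        by blast
    qed
    then obtain p where p: "(f ^^ k) v = poly_act scale p f v" "degree p < Suc m"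
      using k by auto
    have "coeff (monom 1 k - p) k = 1"
      using p Suc by (simp add: coeff_eq_0)
    then have "monom 1 k - p \<noteq> 0"
      by auto
    moreover have "poly_act scale (monom 1 k - p) f v = 0"
      using p by (simp add: poly_act_diff[OF f] poly_act_monom[OF f])
    ultimately show ?thesis by blast
  qed
qed

end

text \<open>
  Split a polynomial that annihilates $v$ into linear factors. A factor with a nonzero root acts
  injectively and can be cancelled, so a power of $f$ remains. A finite basis makes the exponent
  uniform.
\<close>

lemma nilpotent_if_zero_only_eigenvalue:
  fixes scale :: "'f::alg_closed_field \<Rightarrow> 'v::ab_group_add \<Rightarrow> 'v"
  assumes "finite_dimensional_vector_space scale B" and f: "Vector_Spaces.linear scale scale f"
    and ev: "\<And>c v. f v = scale c v \<Longrightarrow> v \<noteq> 0 \<Longrightarrow> c = 0"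
  shows "\<exists>N. \<forall>v. (f ^^ N) v = 0"
proof -
  interpret finite_dimensional_vector_space scale B by fact
  interpret f: Vector_Spaces.linear scale scale f by (rule f)
  have kill: "\<exists>N. (f ^^ N) v = 0" if "p \<noteq> 0" "poly_act scale p f v = 0" for p v
    using that
  proof (induction "degree p" arbitrary: p v)
    case 0
    then obtain c where "p = [:c:]" "c \<noteq> 0"
      by (metis degree_0_id of_nat_0 pCons_0_0)
    then have "v = 0"
      using 0 by (simp add: poly_act_pCons[OF f] poly_act_0[OF f] f.zero)
    then show ?case
      by (intro exI[of _ 0]) simp
  next
    case (Suc m)
    obtain c where "poly p c = 0"
      using alg_closed_imp_poly_has_root[of p] Suc by auto
    then obtain r where r: "p = [:- c, 1:] * r"
      by (auto simp: poly_eq_0_iff_dvd)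
    then have "r \<noteq> 0" "degree r = m"
      using Suc by (auto simp: degree_mult_eq simp del: mult_pCons_left)
    have eq: "f (poly_act scale r f v) = scale c (poly_act scale r f v)"
      using Suc.prems(2) poly_act_linear_factor[OF f] by (simp add: r del: mult_pCons_left)
    show ?case
    proof (cases "c = 0")
      case True
      then have "poly_act scale r f (f v) = 0"
        using eq by (simp add: poly_act_shift[OF f])
      then obtain N where "(f ^^ N) (f v) = 0"
        using Suc.hyps(1) \<open>r \<noteq> 0\<close> \<open>degree r = m\<close> by blast
      then show ?thesis
        by (intro exI[of _ "Suc N"]) (simp add: funpow_swap1)
    next
      case False
      then show ?thesis
        using ev[OF eq] Suc.hyps(1) \<open>r \<noteq> 0\<close> \<open>degree r = m\<close> by blast
    qed
  qed
  have "\<exists>N. (f ^^ N) v = 0" for v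
    using exists_annihilating_poly[OF f, of v] kill by blast
  then obtain N where N: "(f ^^ N v) v = 0" for v
    by metis
  have pow0: "(f ^^ k) 0 = 0" for k
    by (induction k) (simp_all add: f.zero)
  have "(f ^^ (\<Sum>b\<in>B. N b)) v = 0" for v
  proof -
    have "(f ^^ (\<Sum>b\<in>B. N b)) b = 0" if "b \<in> B" for b
    proof -
      have "(\<Sum>b\<in>B. N b) = (\<Sum>b\<in>B - {b}. N b) + N b"
        using that finite_Basis by (simp add: sum.remove)
      then show ?thesis
        using N pow0 by (simp add: funpow_add)
    qed
    then have "B \<subseteq> {v. (f ^^ (\<Sum>b\<in>B. N b)) v = 0}"
      by auto
    then show ?thesis
      using span_minimal[OF _ module_hom.subspace_kernel[OF module_hom_linearI[OF linear_funpow[OF f]]]] span_Basis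
      by blast
  qed
  then show ?thesis by blast
qed


section \<open>Two maps satisfying the q-Weyl relation\<close>

locale q_weyl_pair =
  finite_dimensional_vector_space scale Basis +
  x: Vector_Spaces.linear scale scale x + y: Vector_Spaces.linear scale scale y
  for scale :: "'f::alg_closed_field \<Rightarrow> 'v::ab_group_add \<Rightarrow> 'v" and Basis and x y +
  fixes q :: 'f
  assumes q_nonzero: "q \<noteq> 0" and q_not_root: "n > 0 \<Longrightarrow> q ^ n \<noteq> 1"
    and weyl: "scale q (x (y v)) - scale (inverse q) (y (x v)) = scale (q - inverse q) v"
begin

definition nil :: "'v \<Rightarrow> 'v" where
  "nil v = scale (q / (q - inverse q)) (v - x (y v))"

definition exp_coeff :: "nat \<Rightarrow> 'f" where
  "exp_coeff k = q ^ (k choose 2) / q_fact q k"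

definition exp_term :: "nat \<Rightarrow> 'v \<Rightarrow> 'v" where
  "exp_term k v = scale (exp_coeff k) ((nil ^^ k) v)"

abbreviation E :: "'v \<Rightarrow> 'v" where
  "E \<equiv> exp_q scale q nil"

lemma q_power_eq_iff: "q ^ m = q ^ n \<longleftrightarrow> m = n"
proof (induction m n rule: linorder_wlog)
  case (le m n)
  have "q ^ n = q ^ m * q ^ (n - m)"
    using le by (simp flip: power_add)
  then show ?case
    using q_not_root[of "n - m"] q_nonzero le by (cases "m = n") auto
qed auto

lemma q_square: "q\<^sup>2 \<noteq> 1"
  using q_not_root[of 2] by simp

lemma q_diff_nonzero: "q - inverse q \<noteq> 0"
  using q_square q_nonzero by (auto simp: field_simps power2_eq_square)

text \<open>
  The relation solved for \<open>y x\<close>; used as a rewrite rule, it moves every \<open>x\<close> to the left of \<open>y\<close>.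
\<close>

lemma yx: "y (x v) = scale (q\<^sup>2) (x (y v)) - scale (q\<^sup>2 - 1) v"
proof -
  have "scale q (scale (inverse q) (y (x v))) = scale q (scale q (x (y v)) - scale (q - inverse q) v)"
    using weyl[of v] by (metis diff_diff_eq2 diff_add_cancel add_diff_cancel_left')
  then show ?thesis
    using q_nonzero by (simp add: scale_right_diff_distrib power2_eq_square right_diff_distrib)
qed

text \<open>
  If $x v = 0$ with $v \neq 0$, then the vectors $y^k v$ are eigenvectors of $yx$ with the pairwise
  distinct eigenvalues $1 - q^{-2k}$, and none of them vanishes since $x$ lowers $k$.
\<close>

lemma inj_x: "inj x"
proof (rule ccontr)
  assume "\<not> inj x"
  then obtain v where v: "x v = 0" "v \<noteq> 0"
    using x.inj_iff_eq_0 by blast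
  let ?p = "inverse (q\<^sup>2)"
  have xy: "x (y w) = scale ?p (y (x w)) + scale (1 - ?p) w" for w
    using q_nonzero by (simp add: yx scale_right_diff_distrib right_diff_distrib)
  have eig: "y (x ((y ^^ k) v)) = scale (1 - ?p ^ k) ((y ^^ k) v)" for k
  proof (induction k)
    case 0
    then show ?case by (simp add: v y.zero)
  next
    case (Suc k)
    then show ?case
      by (simp add: xy y.add y.scale left_diff_distrib right_diff_distrib flip: scale_left_distrib)
  qed
  have p_power: "?p ^ k = inverse (q ^ (2 * k))" for k
    by (simp add: power_inverse power_mult)
  have nz: "(y ^^ k) v \<noteq> 0" for k
  proof (induction k)
    case 0
    then show ?case using v by simp
  next
    case (Suc k)
    have "x ((y ^^ Suc k) v) = scale (1 - ?p ^ Suc k) ((y ^^ k) v)"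
      by (simp add: xy eig algebra_simps flip: scale_left_distrib)
    moreover have "?p ^ Suc k \<noteq> 1"
      using q_not_root[of "2 * Suc k"] unfolding p_power inverse_eq_1_iff by simp
    ultimately show ?case
      using Suc x.zero by (metis right_minus_eq scale_eq_0_iff)
  qed
  have lin: "Vector_Spaces.linear scale scale (\<lambda>w. y (x w))"
    by unfold_locales (simp_all add: x.add y.add x.scale y.scale)
  show False
  proof (rule no_infinite_eigenvector_sequence[OF lin eig _ nz])
    show "inj (\<lambda>k. 1 - ?p ^ k)"
      unfolding p_power by (simp add: inj_def q_power_eq_iff)
  qed
qed

lemma surj_x: "surj x"
  by (rule linear_inj_imp_surj[OF x.linear_axioms inj_x])

lemma linear_nil: "Vector_Spaces.linear scale scale nil"
  by unfold_locales
    (simp_all add: nil_def x.add y.add x.scale y.scale algebra_simps)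

sublocale nil: Vector_Spaces.linear scale scale nil
  by (rule linear_nil)

text \<open>
  Thus \<open>nil\<close> has weight $q^{-2}$ under conjugation by \<open>x\<close>.
\<close>

lemma nil_x: "nil (x v) = scale (q\<^sup>2) (x (nil v))"
  by (simp add: nil_def yx x.scale x.diff x.add algebra_simps)

lemma y_nil: "y (nil v) = scale (q\<^sup>2) (nil (y v))"
  by (simp add: nil_def yx y.scale y.diff y.add algebra_simps)

lemma yx_nil: "y (x v) = v - scale (q * (q - inverse q)) (nil v)"
proof -
  have "q * (q - inverse q) * (q / (q - inverse q)) = q\<^sup>2"
    using q_diff_nonzero by (simp add: power2_eq_square)
  then show ?thesis
    by (simp only: nil_def yx scale_scale) (simp add: algebra_simps)
qed

text \<open>
  If $v$ is an eigenvector of \<open>nil\<close> with eigenvalue $c \neq 0$, then $x^k v$ is one with eigenvalue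
  $q^{2k} c$, which is impossible in finite dimension.
\<close>

lemma nil_nilpotent: "\<exists>N. \<forall>v. (nil ^^ N) v = 0"
proof (rule nilpotent_if_zero_only_eigenvalue)
  show "finite_dimensional_vector_space scale Basis"
    by unfold_locales
  show "Vector_Spaces.linear scale scale nil"
    by (rule linear_nil)
next
  fix c v
  assume v: "nil v = scale c v" "v \<noteq> 0"
  show "c = 0"
  proof (rule ccontr)
    assume "c \<noteq> 0"
    have eig: "nil ((x ^^ k) v) = scale (q ^ (2 * k) * c) ((x ^^ k) v)" for k
      by (induction k) (simp_all add: v nil_x x.scale power2_eq_square mult.assoc)
    have nz: "(x ^^ k) v \<noteq> 0" for k
      by (induction k) (use v inj_x in \<open>auto simp: x.inj_iff_eq_0\<close>)
    show False
    proof (rule no_infinite_eigenvector_sequence[OF linear_nil eig _ nz])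
      show "inj (\<lambda>k. q ^ (2 * k) * c)"
        using \<open>c \<noteq> 0\<close> by (simp add: inj_def q_power_eq_iff)
    qed
  qed
qed

text \<open>
  The recursion $[k+1]_q\, a_{k+1} = q^k a_k$ of the coefficients, cleared of denominators. All that
  is used about the q-exponential is this recursion and $a_0 = 1$.
\<close>

lemma exp_coeff_Suc: "exp_coeff (Suc k) * (q ^ (2 * Suc k) - 1) = exp_coeff k * (q ^ (2 * k) * (q * (q - inverse q)))"
proof -
  have qi: "q_int q (int (Suc k)) * (q ^ Suc k * (q - inverse q)) = q ^ (2 * Suc k) - 1"
  proof -
    have "q_int q (int (Suc k)) * (q - inverse q) = q ^ Suc k - inverse (q ^ Suc k)"
      using q_diff_nonzero
      by (simp add: q_int_def power_int_minus power_int_of_nat del: of_nat_Suc power_Suc)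
    then have "q_int q (int (Suc k)) * (q ^ Suc k * (q - inverse q))
        = (q ^ Suc k - inverse (q ^ Suc k)) * q ^ Suc k"
      by (metis mult.assoc mult.commute)
    also have "\<dots> = q ^ (2 * Suc k) - 1"
      using q_nonzero by (simp add: left_diff_distrib mult_2 del: power_Suc flip: power_add)
    finally show ?thesis .
  qed
  then have "q_int q (int (Suc k)) \<noteq> 0"
    using q_not_root[of "2 * Suc k"] by auto
  then have "exp_coeff (Suc k) * q_int q (int (Suc k)) = exp_coeff k * q ^ k"
    by (simp add: exp_coeff_def q_fact_def numeral_2_eq_2 power_add)
  then have "exp_coeff (Suc k) * (q_int q (int (Suc k)) * (q ^ Suc k * (q - inverse q)))
      = exp_coeff k * q ^ k * (q ^ Suc k * (q - inverse q))"
    by (metis mult.assoc)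
  then show ?thesis
    unfolding qi mult_2 power_add by (simp add: mult.assoc mult.left_commute)
qed

lemma exp_coeff_0: "exp_coeff 0 = 1"
  by (simp add: exp_coeff_def q_fact_def binomial_eq_0)

lemma linear_exp_term: "Vector_Spaces.linear scale scale (exp_term k)"
proof -
  interpret p: Vector_Spaces.linear scale scale "nil ^^ k"
    by (rule linear_funpow[OF linear_nil])
  show ?thesis
    by unfold_locales (simp_all add: exp_term_def p.add p.scale algebra_simps)
qed

lemma exp_term_x: "exp_term k (x v) = scale (q ^ (2 * k)) (x (exp_term k v))"
proof -
  have "(nil ^^ k) (x v) = scale (q ^ (2 * k)) (x ((nil ^^ k) v))"
    by (induction k) (simp_all add: nil.scale nil_x power2_eq_square mult.assoc mult.commute)
  then show ?thesis
    by (simp add: exp_term_def x.scale mult.commute)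
qed

text \<open>
  Since $y$ passes \<open>nil\<close> up to $q^2$ and $yx = 1 - q(q - q^{-1})\,$\<open>nil\<close>, the recursion of the
  coefficients makes $y\,t_k\,x$ equal to $t_{k+1}$ plus the telescoping difference
  $q^{2k} t_k - q^{2k+2} t_{k+1}$, where $t_k$ is the $k$-th term of the series.
\<close>

lemma y_exp_term_x:
  "y (exp_term k (x v)) = scale (q ^ (2 * k)) (exp_term k v) - scale (q ^ (2 * Suc k) - 1) (exp_term (Suc k) v)"
proof -
  have pow: "y ((nil ^^ k) w) = scale (q ^ (2 * k)) ((nil ^^ k) (y w))" for w
    by (induction k) (simp_all add: nil.scale y_nil power2_eq_square mult.assoc mult.commute)
  interpret t: Vector_Spaces.linear scale scale "exp_term k" by (rule linear_exp_term)
  have "y (exp_term k (x v)) = scale (q ^ (2 * k)) (exp_term k (y (x v)))"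
    by (simp add: exp_term_def y.scale pow mult.commute)
  also have "\<dots> = scale (q ^ (2 * k)) (exp_term k v)
      - scale (q ^ (2 * k) * (q * (q - inverse q))) (exp_term k (nil v))"
    by (simp only: yx_nil t.diff t.scale scale_right_diff_distrib scale_scale)
  also have "scale (q ^ (2 * k) * (q * (q - inverse q))) (exp_term k (nil v))
      = scale (exp_coeff k * (q ^ (2 * k) * (q * (q - inverse q)))) ((nil ^^ Suc k) v)"
    by (simp add: exp_term_def funpow_swap1 mult.commute)
  also have "\<dots> = scale (q ^ (2 * Suc k) - 1) (exp_term (Suc k) v)"
    unfolding exp_coeff_Suc[symmetric] by (simp add: exp_term_def mult.commute)
  finally show ?thesis .
qed

lemma exp_term_eq_zero:
  assumes "\<And>w. (nil ^^ N) w = 0" "k \<ge> N"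
  shows "exp_term k v = 0"
proof -
  have "(nil ^^ k) v = (nil ^^ N) ((nil ^^ (k - N)) v)"
    using assms(2) by (metis comp_apply funpow_add le_add_diff_inverse)
  then show ?thesis
    using assms(1) by (simp add: exp_term_def)
qed

lemma exp_q_eq_sum:
  assumes "\<And>w. (nil ^^ N) w = 0"
  shows "E v = (\<Sum>k<N. exp_term k v)"
proof -
  have "exp_term k v = 0" if "k \<ge> N" for k
    using assms that by (rule exp_term_eq_zero)
  then have "{k. exp_term k v \<noteq> 0} \<subseteq> {..<N}"
    using not_le by blast
  then show ?thesis
    unfolding exp_q_def exp_term_def exp_coeff_def
    by (intro Sum_any.expand_superset) auto
qed

text \<open>
  That is, $E^{-1} y E = x^{-1}$. The sum of the previous lemma telescopes.
\<close>

lemma y_exp_x: "y (E (x v)) = E v"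
proof -
  obtain N where N: "\<And>w. (nil ^^ N) w = 0"
    using nil_nilpotent by blast
  have "(\<Sum>k<M. y (exp_term k (x v)))
      = (\<Sum>k<M. exp_term k v) - scale (q ^ (2 * M) - 1) (exp_term M v)" for M
    by (induction M) (simp_all add: y_exp_term_x algebra_simps)
  from this[of N] show ?thesis
    by (simp add: exp_q_eq_sum[OF N] y.sum exp_term_eq_zero[OF N])
qed

lemma linear_exp: "Vector_Spaces.linear scale scale E"
proof -
  obtain N where N: "\<And>w. (nil ^^ N) w = 0"
    using nil_nilpotent by blast
  have t: "exp_term k (v + w) = exp_term k v + exp_term k w"
    "exp_term k (scale c v) = scale c (exp_term k v)" for k v w c
  proof -
    interpret t: Vector_Spaces.linear scale scale "exp_term k" by (rule linear_exp_term)
    show "exp_term k (v + w) = exp_term k v + exp_term k w"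
      "exp_term k (scale c v) = scale c (exp_term k v)" by (simp_all add: t.add t.scale)
  qed
  show ?thesis
    by unfold_locales (simp_all add: exp_q_eq_sum[OF N] t sum.distrib scale_sum_right)
qed

text \<open>
  $E$ is the identity plus terms with a factor \<open>nil\<close>: if $E v = 0$ and
  $\mathrm{nil}^{k+1} v = 0$, then applying $\mathrm{nil}^k$ to $E v$ leaves only $\mathrm{nil}^k v$,
  which therefore vanishes. Descending in $k$ gives $v = 0$.
\<close>

lemma bij_exp: "bij E"
proof -
  interpret E: Vector_Spaces.linear scale scale E by (rule linear_exp)
  have "inj E"
    unfolding E.inj_iff_eq_0
  proof (intro allI impI)
    fix v
    assume Ev: "E v = 0"
    obtain N where N: "\<And>w. (nil ^^ N) w = 0"
      using nil_nilpotent by blast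
    then have N': "(nil ^^ Suc N) w = 0" for w
      by (simp add: nil.zero)
    have "(nil ^^ k) v = 0 \<Longrightarrow> v = 0" for k
    proof (induction k)
      case (Suc k)
      interpret p: Vector_Spaces.linear scale scale "nil ^^ k"
        by (rule linear_funpow[OF linear_nil])
      have pow: "(nil ^^ k) ((nil ^^ Suc j) v) = 0" for j
      proof -
        have "(nil ^^ k) ((nil ^^ Suc j) v) = (nil ^^ j) ((nil ^^ Suc k) v)"
          by (metis comp_apply funpow_add add.commute add_Suc)
        then show ?thesis
          using Suc.prems module_hom.zero[OF module_hom_linearI[OF linear_funpow[OF linear_nil]]]
          by metis
      qed
      have "0 = (nil ^^ k) (E v)"
        by (simp add: Ev p.zero)
      also have "\<dots> = (\<Sum>j<Suc N. scale (exp_coeff j) ((nil ^^ k) ((nil ^^ j) v)))"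
        by (simp only: exp_q_eq_sum[OF N'] p.sum exp_term_def p.scale)
      also have "\<dots> = (nil ^^ k) v"
        unfolding sum.lessThan_Suc_shift by (simp only: pow) (simp add: exp_coeff_0)
      finally show ?case
        using Suc.IH by simp
    qed simp
    then show "v = 0"
      using N by blast
  qed
  then show ?thesis
    using linear_inj_imp_surj[OF linear_exp] by (simp add: bij_def)
qed

end


section \<open>Conjugation of the third map by the q-exponential\<close>

text \<open>
  These identities verify that the three weight projections of $z$ (with $p = q^{-1}$ and $C$ a
  normalising factor) have the weights $q^2$ or, after exchanging $q$ and $p$, $q^{-2}$, and that
  they add up to $z$.
\<close>

lemma weight_equations:
  fixes q p C :: "'f::field"
  assumes "q * p = 1"
  shows "q\<^sup>2 * (p * C) = q * C"
    "- ((q + p) * C) = q\<^sup>2 * (q * C) - q * C * (q\<^sup>2 + 1 + p\<^sup>2)"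
    "p * C = q\<^sup>2 * - ((q + p) * C) + q * C * (q\<^sup>2 + 1 + p\<^sup>2)"
proof -
  have e: "p * q = 1" "p * (q * t) = t" "q * (p * t) = t" for t
    using assms by (simp_all add: mult.commute flip: mult.assoc)
  show "q\<^sup>2 * (p * C) = q * C"
    by (simp add: power2_eq_square mult.assoc e)
  show "- ((q + p) * C) = q\<^sup>2 * (q * C) - q * C * (q\<^sup>2 + 1 + p\<^sup>2)"
    "p * C = q\<^sup>2 * - ((q + p) * C) + q * C * (q\<^sup>2 + 1 + p\<^sup>2)"
    by (simp_all add: power2_eq_square algebra_simps e)
qed

lemma weight_sum_equation:
  fixes q p C :: "'f::field"
  assumes "q * p = 1" "(q - p)\<^sup>2 * (q + p) * C = 1"
  shows "- ((q + p) * C) + (q\<^sup>2 + p\<^sup>2) * (q + p) * C + - ((p + q) * C) = 1"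
proof -
  have "q\<^sup>2 + p\<^sup>2 = (q - p)\<^sup>2 + 2"
    unfolding power2_diff mult.assoc assms(1) by simp
  then have "(q\<^sup>2 + p\<^sup>2) * (q + p) * C = (q - p)\<^sup>2 * (q + p) * C + 2 * ((q + p) * C)"
    by (simp only: distrib_right mult.assoc)
  then show ?thesis
    unfolding assms(2) add.commute[of p q] by simp
qed

locale q_serre_triple =
  q_weyl_pair scale Basis x y q + z: Vector_Spaces.linear scale scale z
  for scale :: "'f::alg_closed_field \<Rightarrow> 'v::ab_group_add \<Rightarrow> 'v" and Basis and x y z and q :: 'f +
  assumes weyl_yz: "scale q (y (z v)) - scale (inverse q) (z (y v)) = scale (q - inverse q) v"
    and serre: "x (x (x (z v))) - scale (q_int q 3) (x (x (z (x v))))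
      + scale (q_int q 3) (x (z (x (x v)))) - z (x (x (x v))) = 0"
begin

abbreviation x_inv :: "'v \<Rightarrow> 'v" where
  "x_inv \<equiv> inv_into UNIV x"

text \<open>
  The span of $x z x^{-1}$, $z$ and $x^{-1} z x$. By the cubic relation it is stable under conjugation
  by \<open>x\<close>, and it contains both the weight components of \<open>z\<close> and the right-hand side of the theorem.
\<close>

definition conj_comb :: "'f \<Rightarrow> 'f \<Rightarrow> 'f \<Rightarrow> 'v \<Rightarrow> 'v" where
  "conj_comb a b c v = scale a (x (z (x_inv v))) + scale b (z v) + scale c (x_inv (z (x v)))"

lemma x_x_inv: "x (x_inv v) = v"
  using surj_x by (rule surj_f_inv_f)

lemma x_inv_x: "x_inv (x v) = v"
  using inj_x by (rule inv_f_f)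

lemma conj_comb_scale: "conj_comb a b c (scale r v) = scale r (conj_comb a b c v)"
proof -
  have "x_inv (scale r w) = scale r (x_inv w)" for w
    by (metis x.scale x_inv_x x_x_inv)
  then show ?thesis
    by (simp add: conj_comb_def x.scale z.scale scale_right_distrib mult.commute)
qed

lemma conj_comb_add: "conj_comb a b c v + conj_comb a' b' c' v = conj_comb (a + a') (b + b') (c + c') v"
  by (simp add: conj_comb_def scale_left_distrib algebra_simps)

text \<open>
  The assumptions say that $(a, b, c)$ is an eigenvector of conjugation by \<open>x\<close>. This conjugation sends
  the triple $x z x^{-1}, z, x^{-1} z x$ to $x^2 z x^{-2}, x z x^{-1}, z$, and the cubic relation
  re-expresses the first of these.
\<close>

lemma x_conj_comb:
  assumes "m * c = a" "b = m * a - a * q_int q 3" "c = m * b + a * q_int q 3"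
  shows "x (conj_comb a b c v) = scale m (conj_comb a b c (x v))"
proof -
  \<comment> \<open>With \<open>v = x w\<close> and one more \<open>x\<close> on the left, all inverses of \<open>x\<close> disappear.\<close>
  obtain w where w: "v = x w"
    using surj_x by (metis surjD)
  have X0: "z (x (x (x w))) = x (x (x (z w))) - scale (q_int q 3) (x (x (z (x w))))
      + scale (q_int q 3) (x (z (x (x w))))"
    using serre[of w] by simp
  have "x (x (conj_comb a b c v))
      = scale a (x (x (x (z w)))) + scale b (x (x (z (x w)))) + scale c (x (z (x (x w))))"
    by (simp add: w conj_comb_def x_inv_x x_x_inv x.add x.scale)
  also have "\<dots> = scale (m * a) (x (x (z (x w)))) + scale (m * b) (x (z (x (x w))))
      + scale a (z (x (x (x w))))"
  proof -
    have "scale b w' = scale (m * a) w' - scale (a * q_int q 3) w'" for w'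
      by (simp add: assms(2) scale_left_diff_distrib)
    moreover have "scale c w' = scale (m * b) w' + scale (a * q_int q 3) w'" for w'
      by (simp add: assms(3) scale_left_distrib)
    ultimately show ?thesis
      unfolding X0 by (simp add: scale_right_distrib scale_right_diff_distrib)
  qed
  also have "\<dots> = x (scale m (conj_comb a b c (x v)))"
    using assms(1) by (simp add: w conj_comb_def x_inv_x x_x_inv x.add x.scale scale_right_distrib)
  finally show ?thesis
    using inj_x by (simp add: inj_eq)
qed

text \<open>
  Conjugation by \<open>x\<close> satisfies $(T - q^2)(T - 1)(T - q^{-2}) = 0$ on \<open>z\<close>. The maps \<open>z_plus\<close>, \<open>z_zero\<close>
  and \<open>z_minus\<close> are the projections of \<open>z\<close> to the weights $q^2$, $1$ and $q^{-2}$: each is a normalised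
  $T^{-1}(T - a)(T - b)\,z$, where $a, b$ are the two other weights, multiplied out with
  $T z = x z x^{-1}$ and $T^{-1} z = x^{-1} z x$.
\<close>

definition weight_coeff :: 'f where
  "weight_coeff = 1 / ((q - inverse q) * (q ^ 2 - inverse q ^ 2))"

definition z_plus :: "'v \<Rightarrow> 'v" where
  "z_plus = conj_comb (q * weight_coeff) (- ((q + inverse q) * weight_coeff)) (inverse q * weight_coeff)"

definition z_minus :: "'v \<Rightarrow> 'v" where
  "z_minus = conj_comb (inverse q * weight_coeff) (- ((inverse q + q) * weight_coeff)) (q * weight_coeff)"

definition z_zero :: "'v \<Rightarrow> 'v" where
  "z_zero = conj_comb (- ((q + inverse q) * weight_coeff))
      ((q ^ 2 + inverse q ^ 2) * (q + inverse q) * weight_coeff) (- ((q + inverse q) * weight_coeff))"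

lemma q_int_3: "q_int q 3 = q\<^sup>2 + 1 + inverse q ^ 2"
proof -
  have "q ^ 3 - inverse q ^ 3 = (q\<^sup>2 + 1 + inverse q ^ 2) * (q - inverse q)"
    using q_nonzero by (simp add: algebra_simps power2_eq_square power3_eq_cube)
  then show ?thesis
    using q_diff_nonzero
    by (simp add: q_int_def power_int_minus power_inverse)
qed

lemma weight_coeff_eq: "(q - inverse q) ^ 2 * (q + inverse q) * weight_coeff = 1"
proof -
  have "q\<^sup>2 * (q + inverse q) * (q - inverse q) = q ^ 4 - 1"
    using q_nonzero by (simp add: algebra_simps power2_eq_square power4_eq_xxxx)
  then have "q + inverse q \<noteq> 0"
    using q_not_root[of 4] by auto
  moreover have "q ^ 2 - inverse q ^ 2 = (q - inverse q) * (q + inverse q)"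
    by (simp add: algebra_simps power2_eq_square)
  ultimately show ?thesis
    using q_diff_nonzero by (simp add: weight_coeff_def power2_eq_square)
qed

lemma x_z_plus: "x (z_plus v) = scale (q\<^sup>2) (z_plus (x v))"
  unfolding z_plus_def
proof (rule x_conj_comb)
  note w = weight_equations[OF right_inverse[OF q_nonzero], of weight_coeff]
  show "q\<^sup>2 * (inverse q * weight_coeff) = q * weight_coeff"
    by (rule w(1))
  show "- ((q + inverse q) * weight_coeff) = q\<^sup>2 * (q * weight_coeff) - q * weight_coeff * q_int q 3"
    unfolding q_int_3 by (rule w(2))
  show "inverse q * weight_coeff
      = q\<^sup>2 * - ((q + inverse q) * weight_coeff) + q * weight_coeff * q_int q 3"
    unfolding q_int_3 by (rule w(3))
qed

lemma x_z_zero: "x (z_zero v) = z_zero (x v)"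
proof -
  have "x (z_zero v) = scale 1 (z_zero (x v))"
    unfolding z_zero_def by (rule x_conj_comb) (simp_all add: q_int_3 algebra_simps)
  then show ?thesis by simp
qed

lemma x_z_minus: "x (z_minus v) = scale (inverse q ^ 2) (z_minus (x v))"
  unfolding z_minus_def
proof (rule x_conj_comb)
  note w = weight_equations[OF left_inverse[OF q_nonzero], of weight_coeff]
  have s: "q_int q 3 = inverse q ^ 2 + 1 + q\<^sup>2"
    by (simp add: q_int_3)
  show "inverse q ^ 2 * (q * weight_coeff) = inverse q * weight_coeff"
    by (rule w(1))
  show "- ((inverse q + q) * weight_coeff)
      = inverse q ^ 2 * (inverse q * weight_coeff) - inverse q * weight_coeff * q_int q 3"
    unfolding s by (rule w(2))
  show "q * weight_coeff
      = inverse q ^ 2 * - ((inverse q + q) * weight_coeff) + inverse q * weight_coeff * q_int q 3"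
    unfolding s by (rule w(3))
qed

lemma z_decomposition: "z v = z_plus v + z_zero v + z_minus v"
proof -
  have outer: "q * weight_coeff + - ((q + inverse q) * weight_coeff) + inverse q * weight_coeff = 0"
    "inverse q * weight_coeff + - ((q + inverse q) * weight_coeff) + q * weight_coeff = 0"
    by (simp_all add: distrib_right)
  have "z_plus v + z_zero v + z_minus v = conj_comb 0 1 0 v"
    unfolding z_plus_def z_zero_def z_minus_def conj_comb_add outer
      weight_sum_equation[OF right_inverse[OF q_nonzero] weight_coeff_eq] by (rule refl)
  then show ?thesis
    by (simp add: conj_comb_def)
qed

text \<open>
  The map $w = E^{-1} z E - x$, which turns out to be \<open>z_plus\<close>.
\<close>

definition defect :: "'v \<Rightarrow> 'v" where
  "defect v = inv_into UNIV E (z (E v)) - x v"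

lemma z_exp: "z (E v) = E (x v + defect v)"
  using bij_exp by (simp add: defect_def bij_is_surj surj_f_inv_f)

text \<open>
  Conjugate the relation between \<open>y\<close> and \<open>z\<close> by $E$. It becomes the same relation between $x^{-1}$ and
  $E^{-1} z E = x + w$, where $w$ is the defect. Here \<open>x\<close> itself contributes $q - q^{-1}$, so
  $q\,x^{-1} w = q^{-1} w\,x^{-1}$ remains.
\<close>

lemma x_defect: "x (defect v) = scale (q\<^sup>2) (defect (x v))"
proof -
  interpret E: Vector_Spaces.linear scale scale E by (rule linear_exp)
  define b where "b = x_inv (defect (x v))"
  have b: "x b = defect (x v)"
    by (simp add: b_def x_x_inv)
  have "y (z (E (x v))) = E (x v) + E b"
    by (simp add: z_exp y_exp_x E.add y.add flip: b)
  then have "scale q (E (x v) + E b) - scale (inverse q) (E (x v) + E (defect v))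
      = scale (q - inverse q) (E (x v))"
    using weyl_yz[of "E (x v)"] by (simp add: y_exp_x z_exp E.add)
  then have "E (scale q b) = E (scale (inverse q) (defect v))"
    by (simp add: E.scale algebra_simps)
  then have "scale q b = scale (inverse q) (defect v)"
    using bij_exp by (simp add: bij_is_inj inj_eq)
  then have "scale q (scale q b) = scale q (scale (inverse q) (defect v))"
    by simp
  then have "defect v = scale (q\<^sup>2) b"
    using q_nonzero by (simp add: power2_eq_square)
  then show ?thesis
    by (simp add: x.scale b)
qed

text \<open>
  Compare both sides of $z E = E (x + w)$ weight by weight. The $k$-th term $t_k$ of $E$ has weight
  $q^{-2k}$, so $z_+ t_0 = z_+$ and $t_0 w = w$ are the only parts of weight $q^2$.
\<close>

lemma defect_eq_z_plus: "defect v = z_plus v"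
proof -
  interpret t: Vector_Spaces.linear scale scale "exp_term k" for k by (rule linear_exp_term)
  obtain N where N: "\<And>w. (nil ^^ N) w = 0"
    using nil_nilpotent by blast
  have zs: "z_plus (scale r w) = scale r (z_plus w)" "z_zero (scale r w) = scale r (z_zero w)"
    "z_minus (scale r w) = scale r (z_minus w)" for r w
    by (simp_all add: z_plus_def z_zero_def z_minus_def conj_comb_scale)
  \<comment> \<open>The summand \<open>A k\<close> collects everything of weight $q^{-2k}$ in \<open>z E - E (x + defect)\<close>, and
    \<open>P 0\<close> is the part of weight $q^2$; the shifts in the index account for the weights $q^2$ and
    $q^{-2}$ of the maps multiplying the terms of the series.\<close>
  define P where "P k w = z_plus (exp_term k w) - exp_term k (defect w)" for k w
  define Q where "Q k w = z_zero (exp_term k w) - exp_term k (x w)" for k w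
  define M where "M k w = (case k of 0 \<Rightarrow> 0 | Suc j \<Rightarrow> z_minus (exp_term j w))" for k w
  define A where "A k w = P (Suc k) w + Q k w + M k w" for k w
  have xt: "x (exp_term k w) = scale (inverse (q ^ (2 * k))) (exp_term k (x w))" for k w
    using q_nonzero by (simp add: exp_term_x)
  have P: "x (P k w) = scale (q\<^sup>2 * inverse (q ^ (2 * k))) (P k (x w))" for k w
    by (simp add: P_def x.diff x_z_plus xt zs x_defect t.scale scale_right_diff_distrib mult.commute)
  have Q: "x (Q k w) = scale (inverse (q ^ (2 * k))) (Q k (x w))" for k w
    by (simp add: Q_def x.diff x_z_zero xt zs scale_right_diff_distrib)
  have M: "x (M k w) = scale (inverse (q ^ (2 * k))) (M k (x w))" for k w
    by (cases k) (simp_all add: M_def x.zero x_z_minus xt zs power2_eq_square mult.assoc)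
  have zero: "z_plus 0 = 0" "z_zero 0 = 0" "exp_term k 0 = 0" for k
    using zs[where r = 0] by (simp_all add: t.zero)
  have vanish: "P k w = 0" "Q k w = 0" if "k \<ge> N" for k w
    using that by (simp_all add: P_def Q_def exp_term_eq_zero[OF N] zero)
  have "P 0 v = 0"
  proof (rule weight_component_eq_zero[OF x.linear_axioms surj_x finite_lessThan[of "Suc N"],
        where A = A and wt = "\<lambda>k. inverse (q ^ (2 * k))" and C = "P 0" and \<mu> = "q\<^sup>2"])
    show "x (A k w) = scale (inverse (q ^ (2 * k))) (A k (x w))" for k w
    proof -
      have "q\<^sup>2 * inverse (q ^ (2 * Suc k)) = inverse (q ^ (2 * k))"
        using q_nonzero by (simp add: power_add field_simps power2_eq_square)
      then show ?thesis
        unfolding A_def x.add P Q M by (simp only: scale_right_distrib)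
    qed
    show "x (P 0 w) = scale (q\<^sup>2) (P 0 (x w))" for w
      using P[of 0 w] by simp
    show "inverse (q ^ (2 * k)) \<noteq> q\<^sup>2" for k
    proof
      assume "inverse (q ^ (2 * k)) = q\<^sup>2"
      then have "q\<^sup>2 * q ^ (2 * k) = 1"
        using q_nonzero by (metis left_inverse power_not_zero)
      then have "q ^ (2 + 2 * k) = 1"
        by (simp only: power_add)
      then show False
        using q_not_root[of "2 + 2 * k"] by simp
    qed
    show "(\<Sum>k<Suc N. A k w) + P 0 w = 0" for w
    proof -
      have "(\<Sum>k<Suc N. P (Suc k) w) + P 0 w = (\<Sum>k<Suc (Suc N). P k w)"
        by (simp only: sum.lessThan_Suc_shift add.commute)
      also have "\<dots> = (\<Sum>k<N. P k w)"
        by (simp add: vanish)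
      finally have sP: "(\<Sum>k<Suc N. P (Suc k) w) + P 0 w = (\<Sum>k<N. P k w)" .
      have sQ: "(\<Sum>k<Suc N. Q k w) = (\<Sum>k<N. Q k w)"
        by (simp add: vanish)
      have sM: "(\<Sum>k<Suc N. M k w) = (\<Sum>k<N. z_minus (exp_term k w))"
        unfolding sum.lessThan_Suc_shift by (simp add: M_def)
      have "(\<Sum>k<Suc N. A k w) + P 0 w
          = ((\<Sum>k<Suc N. P (Suc k) w) + P 0 w) + (\<Sum>k<Suc N. Q k w) + (\<Sum>k<Suc N. M k w)"
        by (simp add: A_def sum.distrib)
      also have "\<dots> = (\<Sum>k<N. z_plus (exp_term k w) + z_zero (exp_term k w) + z_minus (exp_term k w))
          - (\<Sum>k<N. exp_term k (x w + defect w))"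
        unfolding sP sQ sM by (simp add: P_def Q_def t.add sum.distrib sum_subtractf)
      also have "\<dots> = (\<Sum>k<N. z (exp_term k w)) - (\<Sum>k<N. exp_term k (x w + defect w))"
        by (simp only: flip: z_decomposition)
      also have "\<dots> = z (E w) - E (x w + defect w)"
        by (simp add: exp_q_eq_sum[OF N] z.sum)
      finally show ?thesis
        by (simp add: z_exp)
    qed
  qed
  then show ?thesis
    by (simp add: P_def exp_term_def exp_coeff_0)
qed

lemma z_exp_eq:
  "inv_into UNIV E (z (E v)) = x v
     - scale (1 / (q - inverse q) ^ 2) (z v)
     + scale (q / ((q - inverse q) * (q ^ 2 - inverse q ^ 2))) (x (z (x_inv v)))
     + scale (inverse q / ((q - inverse q) * (q ^ 2 - inverse q ^ 2))) (x_inv (z (x v)))"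
proof -
  have "(q + inverse q) * weight_coeff = 1 / (q - inverse q) ^ 2"
    using weight_coeff_eq q_diff_nonzero by (simp add: eq_divide_eq ac_simps)
  then have "z_plus v = - scale (1 / (q - inverse q) ^ 2) (z v)
     + scale (q / ((q - inverse q) * (q ^ 2 - inverse q ^ 2))) (x (z (x_inv v)))
     + scale (inverse q / ((q - inverse q) * (q ^ 2 - inverse q ^ 2))) (x_inv (z (x v)))"
    by (simp add: z_plus_def conj_comb_def weight_coeff_def)
  then show ?thesis
    using defect_eq_z_plus[of v] by (simp add: defect_def algebra_simps)
qed

end


section \<open>Modules over the quotient algebra\<close>

context square_q_module
begin

text \<open>
  The algebra is a quotient of the free algebra, so a module is a representation of the free algebra
  that kills the defining relations; here this is read off as identities between the generators.
\<close>

abbreviation free_act :: "'f free_alg \<Rightarrow> 'v \<Rightarrow> 'v" where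
  "free_act p \<equiv> act (square_class q p)"

lemma free_act_add: "free_act (p + r) v = free_act p v + free_act r v"
  using ring_hom_add[OF square_class_hom, of p r q] act_add[OF square_class_carrier square_class_carrier]
  by (simp add: free_ring_def)

lemma free_act_mult: "free_act (p * r) v = free_act p (free_act r v)"
  using ring_hom_mult[OF square_class_hom, of p r q] act_mult[OF square_class_carrier square_class_carrier]
  by (simp add: free_ring_def)

lemma free_act_one: "free_act 1 v = v"
  using ring_hom_one[OF square_class_hom, of q] act_one by (simp add: free_ring_def)

lemma free_act_const: "free_act (free_const c) v = scale c v"
  by (rule act_const)

lemma free_act_diff: "free_act (p - r) v = free_act p v - free_act r v"
  using free_act_add[of "p - r" r v] by simp

lemma free_act_rel:
  assumes "p \<in> square_rels q"
  shows "free_act p v = 0"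
proof -
  have "square_class q 0 = \<zero>\<^bsub>square_q q\<^esub>"
    using ring_hom_zero[OF square_class_hom ring_free_ring, of q]
      ideal.quotient_is_ring[OF ideal_square_ideal[of q]]
    by (simp add: free_ring_def square_q_def)
  moreover have "free_act 0 v = 0"
    using free_act_add[of 0 0 v] by simp
  ultimately show ?thesis
    using square_class_rel[OF assms] by simp
qed

lemma linear_gen: "Vector_Spaces.linear scale scale (act (square_gen q j))"
  unfolding square_gen_def by (rule act_linear[OF square_class_carrier])

lemma gen_weyl:
  assumes "q - inverse q \<noteq> 0"
  shows "scale q (act (square_gen q j) (act (square_gen q (j + 1)) v))
    - scale (inverse q) (act (square_gen q (j + 1)) (act (square_gen q j) v)) = scale (q - inverse q) v"
    (is "?lhs = _")
proof -
  have "scale (1 / (q - inverse q)) ?lhs - v = 0"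
    using free_act_rel[of "free_const (1 / (q - inverse q)) *
             (free_const q * free_gen j * free_gen (j + 1)
                - free_const (inverse q) * free_gen (j + 1) * free_gen j) - 1" v]
    unfolding free_act_diff free_act_mult free_act_const free_act_one square_gen_def
    by (auto simp: square_rels_def)
  then have "scale (q - inverse q) (scale (1 / (q - inverse q)) ?lhs) = scale (q - inverse q) v"
    by simp
  then show ?thesis
    using assms by simp
qed

lemma gen_serre:
  fixes j
  defines "x \<equiv> act (square_gen q j)" and "z \<equiv> act (square_gen q (j + 2))"
  shows "x (x (x (z v))) - scale (q_int q 3) (x (x (z (x v))))
      + scale (q_int q 3) (x (z (x (x v)))) - z (x (x (x v))) = 0"
  using free_act_rel[of "free_gen j ^ 3 * free_gen (j + 2)
             - free_const (q_int q 3) * free_gen j ^ 2 * free_gen (j + 2) * free_gen j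
             + free_const (q_int q 3) * free_gen j * free_gen (j + 2) * free_gen j ^ 2
             - free_gen (j + 2) * free_gen j ^ 3" v]
  unfolding x_def z_def square_gen_def power3_eq_cube power2_eq_square
    free_act_diff free_act_add free_act_mult free_act_const
  by (auto simp: square_rels_def power3_eq_cube power2_eq_square)

lemma act_square_nil:
  "act (square_nil q j) v
    = scale (q / (q - inverse q)) (v - act (square_gen q j) (act (square_gen q (j + 1)) v))"
  unfolding square_nil_def square_gen_def free_act_mult free_act_diff free_act_const free_act_one ..

end

theorem theorem9p5:
  fixes q :: "'f::alg_closed_field"
    and scale :: "'f \<Rightarrow> 'v::ab_group_add \<Rightarrow> 'v"
    and act :: "'f free_alg set \<Rightarrow> 'v \<Rightarrow> 'v"
    and i :: 4
  assumes "q \<noteq> 0"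
    and "\<forall>n::nat. n > 0 \<longrightarrow> q ^ n \<noteq> 1"
    and "square_q_module scale q act"
    and "\<exists>B. finite_dimensional_vector_space scale B"
    and "\<exists>v::'v. v \<noteq> 0"
  shows "let x = (\<lambda>j. act (square_gen q j));
             xi_inv = inv_into UNIV (x i);
             E = exp_q scale q (act (square_nil q i))
         in inv_into UNIV E \<circ> x (i + 2) \<circ> E =
            (\<lambda>v. x i v
               - scale (1 / (q - inverse q) ^ 2) (x (i + 2) v)
               + scale (q / ((q - inverse q) * (q ^ 2 - inverse q ^ 2)))
                   (x i (x (i + 2) (xi_inv v)))
               + scale (inverse q / ((q - inverse q) * (q ^ 2 - inverse q ^ 2)))
                   (xi_inv (x (i + 2) (x i v))))"
proof -
  obtain B where B: "finite_dimensional_vector_space scale B"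
    using assms(4) by blast
  interpret M: square_q_module scale q act by (rule assms(3))
  have "q\<^sup>2 \<noteq> 1"
    using assms(2) by simp
  then have q: "q - inverse q \<noteq> 0"
    using assms(1) by (auto simp: field_simps power2_eq_square)
  have two: "i + 1 + 1 = i + 2"
    by (simp add: add.assoc)
  interpret finite_dimensional_vector_space scale B by (rule B)
  interpret T: q_serre_triple scale B "act (square_gen q i)" "act (square_gen q (i + 1))"
    "act (square_gen q (i + 2))" q
  proof (intro q_serre_triple.intro q_weyl_pair.intro q_weyl_pair_axioms.intro
      q_serre_triple_axioms.intro B M.linear_gen)
    show "q ^ n \<noteq> 1" if "0 < n" for n :: nat
      using assms(2) that by blast
  qed (use M.gen_weyl[OF q, of "i + 1"] M.gen_weyl[OF q, of i] M.gen_serre[of i] assms(1)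
      in \<open>simp_all add: two\<close>)
  have nil: "T.nil = act (square_nil q i)"
    by (rule ext) (simp add: T.nil_def M.act_square_nil)
  show ?thesis
    using T.z_exp_eq unfolding nil Let_def comp_def by (intro ext)
qed

end
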